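(* The process $Y=\{Y(t),t\ge0\}$ is non-negative almost surely (i.e. almost surely $Y(t)\ge0$ for all $t\ge0$), so that $$\{t\ge0\mid Y(t)\le0\}=\{t\ge0\mid Y(t)=0\}\quad\text{almost surely}.$$
   Context: $B^H=\{B^H(t),t\ge0\}$ is a fractional Brownian motion with Hurst index $H\in(0,1/2)$ on a probability space $(\Omega,\mathcal F,\mathbb P)$, i.e. a centered Gaussian process with covariance $\mathbb E[B^H(t)B^H(s)]=\frac12(t^{2H}+s^{2H}-|t-s|^{2H})$ and continuous paths starting at $0$. $Y_0,k,a,\sigma>0$ are constants. For $\varepsilon>0$, $Y_\varepsilon=\{Y_\varepsilon(t),t\ge0\}$ is the unique (pathwise, continuous) solution of $$Y_\varepsilon(t)=Y_0+\int_0^t\frac{k}{Y_\varepsilon(s)\mathbf 1_{\{Y_\varepsilon(s)>0\}}+\varepsilon}\,ds-a\int_0^tY_\varepsilon(s)\,ds+\sigma B^H(t),\quad t\ge0.$$ $Y_\varepsilon(t)$ increases as $\varepsilon$ decreases, and $Y(t)=\lim_{\varepsilon\downarrow0}Y_\varepsilon(t)$, $t\ge0$, is the pointwise limit. Only finite and locally Lebesgue integrable paths of $Y$ are considered (this excludes only a null set). *)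

theory Defs
  imports "HOL-Probability.Probability"
begin

text \<open>
  Real Gaussian random variables. The first disjunct covers the variance-zero case, which has no
  density; it is needed because, for example, \<open>B 0 = 0\<close>.
\<close>

definition gaussian_rv :: "'a measure \<Rightarrow> ('a \<Rightarrow> real) \<Rightarrow> bool" where
  "gaussian_rv M X \<longleftrightarrow> X \<in> borel_measurable M \<and>
     ((\<exists>m. AE w in M. X w = m) \<or>
      (\<exists>m s. s > 0 \<and> distributed M lborel X (\<lambda>x. ennreal (normal_density m s x))))"

definition gaussian_process :: "'a measure \<Rightarrow> 'i set \<Rightarrow> ('i \<Rightarrow> 'a \<Rightarrow> real) \<Rightarrow> bool" where
  "gaussian_process M T X \<longleftrightarrow>
     (\<forall>I c. finite I \<longrightarrow> I \<subseteq> T \<longrightarrow> gaussian_rv M (\<lambda>w. \<Sum>t\<in>I. c t * X t w))"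

definition fractional_brownian_motion ::
  "'a measure \<Rightarrow> real \<Rightarrow> (real \<Rightarrow> 'a \<Rightarrow> real) \<Rightarrow> bool" where
  "fractional_brownian_motion M H B \<longleftrightarrow>
     prob_space M \<and>
     gaussian_process M {0..} B \<and>
     (\<forall>t\<ge>0. (LINT w|M. B t w) = 0) \<and>
     (\<forall>t\<ge>0. \<forall>s\<ge>0. (LINT w|M. B t w * B s w)
        = (t powr (2 * H) + s powr (2 * H) - \<bar>t - s\<bar> powr (2 * H)) / 2) \<and>
     (\<forall>w\<in>space M. continuous_on {0..} (\<lambda>t. B t w) \<and> B 0 w = 0)"

text \<open>
  The equation is solved pathwise: \<open>b\<close> is one path of the driving process and \<open>y\<close> the
  corresponding path of the solution. For \<open>e > 0\<close> both integrands are continuous, so the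
  integrals exist.
\<close>

definition solves_eps_equation ::
  "real \<Rightarrow> real \<Rightarrow> real \<Rightarrow> real \<Rightarrow> real \<Rightarrow> (real \<Rightarrow> real) \<Rightarrow> (real \<Rightarrow> real) \<Rightarrow> bool" where
  "solves_eps_equation Y0 k a \<sigma> e b y \<longleftrightarrow>
     continuous_on {0..} y \<and>
     (\<forall>t\<ge>0. y t = Y0 + (LINT s:{0..t}|lborel. k / (y s * indicator {0<..} (y s) + e))
                  - a * (LINT s:{0..t}|lborel. y s) + \<sigma> * b t)"

end

theory Submission
  imports Defs
begin

text \<open>
  If the limit were negative at \<open>t\<close>, then for small \<open>e\<close> the path of the \<open>e\<close>-equation would be
  negative on a whole interval \<open>(s, t]\<close> with a nonnegative value at \<open>s\<close>. On that interval the
  singular drift is \<open>k / e\<close> and the mean-reverting drift pushes upwards, so the drop from \<open>s\<close> to \<open>t\<close>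
  must come from the noise; continuity of the noise keeps \<open>t - s\<close> away from \<open>0\<close> uniformly
  in \<open>e\<close>. The drift then contributes at least a constant times \<open>1 / e\<close>, which
  exceeds the bounded noise as \<open>e\<close> tends to \<open>0\<close>.
\<close>

text \<open>The times in \<open>{0..t}\<close> with \<open>0 \<le> y u\<close> form a compact set
  containing \<open>0\<close>, so a largest one exists. If \<open>0 \<le> y t\<close>, it is
  \<open>t\<close> itself.\<close>

lemma last_nonneg_before:
  fixes y :: "real \<Rightarrow> real"
  assumes "continuous_on {0..t} y" "0 \<le> y 0" "0 \<le> t"
  obtains s where "s \<in> {0..t}" "0 \<le> y s" "\<And>u. u \<in> {s<..t} \<Longrightarrow> y u < 0"
proof -
  let ?S = "{u \<in> {0..t}. 0 \<le> y u}"
  have "closed ?S"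
    using continuous_closed_preimage[OF assms(1) closed_atLeastAtMost, of "{0..}"]
    by (simp add: vimage_def Int_def conj_commute)
  then have "compact ?S"
    unfolding compact_eq_bounded_closed
    by (auto intro: bounded_subset[OF bounded_closed_interval[of 0 t]])
  moreover have "?S \<noteq> {}" using assms by auto
  ultimately obtain s where s: "s \<in> ?S" and last: "\<forall>u\<in>?S. u \<le> s"
    using compact_attains_sup[of ?S] by blast
  show thesis
  proof (rule that)
    show "y u < 0" if "u \<in> {s<..t}" for u
      using bspec[OF last, of u] s that by force
  qed (use s in auto)
qed

text \<open>Take \<open>s\<close> as the last time up to \<open>t\<close> with
  \<open>0 \<le> y s\<close> and subtract the equation at \<open>s\<close> from that at
  \<open>t\<close>. The path enters the bound only through \<open>s\<close>, which lets
  \<open>e\<close> vary later.\<close>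

lemma solves_eps_equation_lower_bound:
  assumes sol: "solves_eps_equation Y0 k a \<sigma> e b y"
    and "b 0 = 0" "0 \<le> Y0" "0 \<le> a" "0 < e" "0 \<le> t"
  obtains s where "s \<in> {0..t}" "k / e * (t - s) + \<sigma> * (b t - b s) \<le> y t"
proof -
  let ?f = "\<lambda>u. k / (y u * indicator {0<..} (y u) + e)"
  \<comment> \<open>Written with \<open>max\<close>, the integrand is visibly continuous, with
    denominator at least \<open>e\<close>.\<close>
  have f_eq: "?f = (\<lambda>u. k / (max (y u) 0 + e))"
    by (auto simp: fun_eq_iff indicator_def)
  have cont: "continuous_on {0..t} y"
    using sol unfolding solves_eps_equation_def by (auto intro: continuous_on_subset)
  have cont_f: "continuous_on {0..t} ?f"
    unfolding f_eq using cont \<open>0 < e\<close>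
    by (intro continuous_intros) (auto simp: add_nonneg_pos less_imp_neq[symmetric])
  have eq: "y r = Y0 + (LINT u:{0..r}|lborel. ?f u) - a * (LINT u:{0..r}|lborel. y u) + \<sigma> * b r"
    if "0 \<le> r" for r
    using sol that unfolding solves_eps_equation_def by blast
  \<comment> \<open>A point is a null set, so the equation at time \<open>0\<close> reduces to
    \<open>y 0 = Y0\<close>.\<close>
  have "(LINT u:{0..0}|lborel. g u) = 0" for g :: "real \<Rightarrow> real"
    unfolding set_lebesgue_integral_def
    by (rule integral_eq_zero_AE, rule eventually_mono[OF AE_lborel_singleton[of 0]]) auto
  then have "0 \<le> y 0"
    using eq[of 0] assms by simp
  then obtain s where s: "s \<in> {0..t}" "0 \<le> y s" and neg: "\<And>u. u \<in> {s<..t} \<Longrightarrow> y u < 0"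
    using last_nonneg_before[OF cont] \<open>0 \<le> t\<close> by blast
  \<comment> \<open>The second piece omits \<open>s\<close>, which makes the pieces disjoint and
    \<open>y\<close> negative throughout the second.\<close>
  have split: "(LINT u:{0..t}|lborel. g u)
      = (LINT u:{0..s}|lborel. g u) + (LINT u:{s<..t}|lborel. g u)"
    if "continuous_on {0..t} g" for g :: "real \<Rightarrow> real"
  proof -
    have "{0..t} = {0..s} \<union> {s<..t}" using s by auto
    moreover have int: "set_integrable lborel {0..t} g"
      using borel_integrable_atLeastAtMost'[OF that] .
    ultimately show ?thesis
      using s by (auto intro!: set_integral_Un set_integrable_subset[OF int])
  qed
  have "(LINT u:{s<..t}|lborel. ?f u) = (LINT u:{s<..t}|lborel. k / e)"
    using neg by (intro set_lebesgue_integral_cong) (auto simp: indicator_def dest: less_asym)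
  also have "\<dots> = k / e * (t - s)"
    using s by (simp add: set_lebesgue_integral_def)
  finally have drift: "(LINT u:{s<..t}|lborel. ?f u) = k / e * (t - s)" .
  have "0 \<le> (LINT u:{s<..t}|lborel. - y u)"
    using neg unfolding set_lebesgue_integral_def
    by (intro integral_nonneg_AE AE_I2) (auto simp: indicator_def less_imp_le)
  then have "a * (LINT u:{s<..t}|lborel. y u) \<le> 0"
    using \<open>0 \<le> a\<close> by (simp add: set_lebesgue_integral_def mult_nonneg_nonpos)
  moreover have "y t - y s = k / e * (t - s) - a * (LINT u:{s<..t}|lborel. y u) + \<sigma> * (b t - b s)"
    using eq[of t] eq[of s] s split[OF cont] split[OF cont_f] drift
    by (simp add: algebra_simps)
  ultimately show thesis using s by (intro that[of s]) linarith+
qed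

text \<open>The time \<open>s\<close> of the lower bound depends on \<open>e\<close>, but the
  constants \<open>d\<close> and \<open>C\<close> below depend only on \<open>b\<close>,
  \<open>\<sigma>\<close>, \<open>t\<close> and \<open>L\<close>, so one small \<open>e\<close>
  gives the contradiction.\<close>

lemma eps_limit_nonneg:
  fixes y :: "real \<Rightarrow> real \<Rightarrow> real"
  assumes sol: "\<And>e. 0 < e \<Longrightarrow> solves_eps_equation Y0 k a \<sigma> e b (y e)"
    and b: "continuous_on {0..} b" "b 0 = 0"
    and pos: "0 \<le> Y0" "0 < k" "0 \<le> a" "0 \<le> t"
    and lim: "((\<lambda>e. y e t) \<longlongrightarrow> L) (at_right 0)"
  shows "0 \<le> L"
proof (rule ccontr)
  assume "\<not> 0 \<le> L"
  \<comment> \<open>The level \<open>L / 2\<close> lies strictly between the limit and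
    \<open>0\<close>: \<open>y e t\<close> eventually falls below it, while small noise stays above
    it.\<close>
  then have "L < L / 2" "L / 2 < 0" by simp_all
  define g where "g u = \<sigma> * (b t - b u)" for u
  have g: "continuous_on {0..} g"
    unfolding g_def using b(1) by (intro continuous_intros)
  \<comment> \<open>This is continuity of \<open>g\<close> at \<open>t\<close>, where
    \<open>g t = 0\<close>.\<close>
  have "\<exists>d>0. \<forall>u\<in>{0..}. dist u t < d \<longrightarrow> dist (g u) (g t) < - (L / 2)"
    using g \<open>0 \<le> t\<close> \<open>L / 2 < 0\<close> unfolding continuous_on_iff
    by (meson atLeast_iff neg_0_less_iff_less)
  then obtain d where d: "0 < d" "\<And>u. 0 \<le> u \<Longrightarrow> \<bar>u - t\<bar> < d \<Longrightarrow> \<bar>g u\<bar> < - (L / 2)"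
    by (auto simp: dist_real_def g_def)
  have "compact (g ` {0..t})"
    using g by (intro compact_continuous_image) (auto intro: continuous_on_subset)
  then obtain C where C: "0 < C" "\<And>u. u \<in> {0..t} \<Longrightarrow> \<bar>g u\<bar> \<le> C"
    using bounded_pos[of "g ` {0..t}"] compact_imp_bounded by auto
  have "\<forall>\<^sub>F e in at_right 0. y e t < L / 2"
    using order_tendstoD(2)[OF lim \<open>L < L / 2\<close>] .
  \<comment> \<open>The bound \<open>k * d / C\<close> is chosen so that the drift accumulated over
    a time \<open>d\<close> exceeds the largest noise increment \<open>C\<close>.\<close>
  moreover have "\<forall>\<^sub>F e in at_right 0. e \<in> {0<..<k * d / C}"
    using d C pos by (intro eventually_at_right_real) simp
  ultimately have "\<forall>\<^sub>F e in at_right (0::real). False"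
  proof eventually_elim
    case (elim e)
    then have "0 < e" and large: "C < k / e * d"
      using C by (auto simp: field_simps)
    obtain s where s: "s \<in> {0..t}" "k / e * (t - s) + g s \<le> y e t"
      using solves_eps_equation_lower_bound[OF sol[OF \<open>0 < e\<close>] b(2) pos(1,3) \<open>0 < e\<close> pos(4)]
      unfolding g_def by blast
    show False
    \<comment> \<open>If \<open>s\<close> is close to \<open>t\<close>, the noise alone keeps
      \<open>y e t\<close> above \<open>L / 2\<close>; otherwise the drift outweighs the noise and
      \<open>y e t\<close> is positive.\<close>
    proof (cases "t - s < d")
      case True
      then have "\<bar>g s\<bar> < - (L / 2)" using d(2)[of s] s by auto
      moreover have "0 \<le> k / e * (t - s)" using s pos \<open>0 < e\<close> by simp
      ultimately show False using s elim by linarith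
    next
      case False
      then have "k / e * d \<le> k / e * (t - s)"
        using pos \<open>0 < e\<close> by (intro mult_left_mono) auto
      then show False using large C(2)[OF s(1)] s elim \<open>L / 2 < 0\<close> by linarith
    qed
  qed
  \<comment> \<open>The filter \<open>at_right 0\<close> on the reals is nontrivial.\<close>
  then show False by simp
qed

theorem lemma3p3:
  fixes M :: "'a measure"
    and B :: "real \<Rightarrow> 'a \<Rightarrow> real"
    and Yeps :: "real \<Rightarrow> real \<Rightarrow> 'a \<Rightarrow> real"
    and Y :: "real \<Rightarrow> 'a \<Rightarrow> real"
    and H Y0 k a \<sigma> :: real
  assumes "0 < H" "H < 1 / 2"
    and "fractional_brownian_motion M H B"
    and "0 < Y0" "0 < k" "0 < a" "0 < \<sigma>"
    and "\<And>e w. e > 0 \<Longrightarrow> w \<in> space M \<Longrightarrow>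
           solves_eps_equation Y0 k a \<sigma> e (\<lambda>t. B t w) (\<lambda>t. Yeps e t w)"
    and "AE w in M. (\<forall>t\<ge>0. ((\<lambda>e. Yeps e t w) \<longlongrightarrow> Y t w) (at_right 0)) \<and>
                    (\<forall>T\<ge>0. (\<lambda>t. Y t w) absolutely_integrable_on {0..T})"
  shows "(AE w in M. \<forall>t\<ge>0. Y t w \<ge> 0) \<and>
         (AE w in M. {t. t \<ge> 0 \<and> Y t w \<le> 0} = {t. t \<ge> 0 \<and> Y t w = 0})"
proof -
  note fbm = assms(3)[unfolded fractional_brownian_motion_def]
  have "AE w in M. \<forall>t\<ge>0. Y t w \<ge> 0"
    \<comment> \<open>The null set is fixed before \<open>t\<close>: outside it, convergence holds
      at all times at once, so the pathwise lemma applies to every \<open>t\<close>.\<close>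
    using assms(9) AE_space
  proof eventually_elim
    case (elim w)
    show ?case
    proof (intro allI impI)
      fix t :: real assume "0 \<le> t"
      show "0 \<le> Y t w"
      proof (rule eps_limit_nonneg[where y = "\<lambda>e t. Yeps e t w"])
        show "solves_eps_equation Y0 k a \<sigma> e (\<lambda>t. B t w) (\<lambda>t. Yeps e t w)" if "0 < e" for e
          using assms(8)[OF that] elim by blast
        show "((\<lambda>e. Yeps e t w) \<longlongrightarrow> Y t w) (at_right 0)"
          using elim \<open>0 \<le> t\<close> by blast
        show "continuous_on {0..} (\<lambda>t. B t w)" "B 0 w = 0"
          using fbm elim by blast+
      qed (use assms(4-6) \<open>0 \<le> t\<close> in simp_all)
    qed
  qed
  moreover from this have "AE w in M. {t. t \<ge> 0 \<and> Y t w \<le> 0} = {t. t \<ge> 0 \<and> Y t w = 0}"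
    by (rule eventually_mono) (simp add: set_eq_iff, metis order_antisym order_refl)
  ultimately show ?thesis ..
qed

end
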